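(* Let $\mathcal{G}$ be a locally compact Hausdorff étale minimal ample groupoid whose unit space $\mathcal{G}^{(0)}$ is compact. Consider the following properties. (i) $\mathcal{G}$ has groupoid comparison and $M(\mathcal{G})=\emptyset$. (ii) $\mathcal{G}$ is purely infinite. (ii') $\mathcal{G}$ is purely infinite in the sense of Matui. (iii) $\mathcal{G}$ is $n$-filling for some $n\in\mathbb{N}$, $n\geq 1$. (iv) $\mathcal{G}$ is $1$-filling. (v) $\mathcal{G}$ is locally contracting. Then (i), (ii), (ii'), (iii) and (iv) are equivalent, and they imply (v).
   Context: Standing assumption: all groupoids have infinite unit space. $\mathcal{G}^{(0)}$ is the unit space, $s(\gamma)=\gamma^{-1}\gamma$, $r(\gamma)=\gamma\gamma^{-1}$. For $A,B\subset\mathcal G$, $AB$ is the set of products $\alpha\beta$ of composable pairs with $\alpha\in A$, $\beta\in B$; in particular $\mathcal G D=\{\gamma: s(\gamma)\in D\}$ for $D\subset\mathcal G^{(0)}$. $D$ is $\mathcal G$-invariant if $r(\mathcal G D)=D$. $\mathcal G$ is minimal if there are no proper non-empty closed $\mathcal G$-invariant subsets of $\mathcal G^{(0)}$. An open bisection is an open set $U\subset\mathcal G$ such that $s|_U$ and $r|_U$ are homeomorphisms onto open subsets of $\mathcal G^{(0)}$. $\mathcal G$ is ample if its topology has a basis of compact open bisections. For $K\subset\mathcal G^{(0)}$ compact and $V\subset\mathcal G^{(0)}$ open, $K\prec_{\mathcal G}V$ means there are open bisections $A_1,\dots,A_n$ with $K\subset\bigcup_i s(A_i)$ and with $r(A_1),\dots,r(A_n)$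 pairwise disjoint subsets of $V$. For open $U,V$: $U\prec_{\mathcal G}V$ means $K\prec_{\mathcal G}V$ for every compact $K\subset U$; for non-empty open $U,V$, $U\prec_{\mathcal G,2}V$ means that for every compact $F\subset U$ there are disjoint non-empty open $O_1,O_2\subset V$ with $F\prec_{\mathcal G}O_1$ and $F\prec_{\mathcal G}O_2$. $M(\mathcal G)$ is the set of regular Borel probability measures $\mu$ on $\mathcal G^{(0)}$ with $\mu(r(U))=\mu(s(U))$ for every open bisection $U$. $\mathcal G$ has groupoid comparison if $U\prec_{\mathcal G}V$ for all open sets $U,V\subset\mathcal G^{(0)}$, $V\ne\emptyset$, with $\mu(U)<\mu(V)$ for all $\mu\in M(\mathcal G)$ (so if $M(\mathcal G)=\emptyset$ this means $U\prec_{\mathcal G}V$ for all non-empty open $U,V$). $\mathcal G$ is purely infinite if $O_1\prec_{\mathcal G,2}O_2$ for all non-empty open $O_1,O_2\subset\mathcal G^{(0)}$ with $O_1\subset r(\mathcal G O_2)$. $\mathcal G$ is purely infinite in the sense of Matui if for every compact open $O\subset\mathcal G^{(0)}$ there are compact open bisections $U,V$ with $s(U)=s(V)=O$, $r(U)\cap r(V)=\emptyset$ and $r(U)\cup r(V)\subset O$. $\mathcal G$ (with compact unit space) is $n$-filling if for every non-empty open $W\subset\mathcal G^{(0)}$ there are $n$ open bisections $E_1,\dots,E_n$ with $\bigcup_{i=1}^n r(E_iW)=\mathcal G^{(0)}$. $\mathcal G$ is locally contracting if for every non-empty open $U\subset\mathcal G^{(0)}$ there are an open subset $V\subset U$ and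 an open bisection $O$ with $\overline V\subset s(O)$ and $r(O\overline V)\subsetneq V$. *)

theory Defs
  imports "HOL-Probability.Probability_Measure"
begin

text \<open>
  The arrow set is the carrier of the topology. The product is a total HOL function that is only
  meaningful on the set \<open>comps\<close> of composable pairs.
\<close>

record 'a top_groupoid =
  gtop :: "'a topology"
  comps :: "('a \<times> 'a) set"
  gmult :: "'a \<Rightarrow> 'a \<Rightarrow> 'a"
  ginv :: "'a \<Rightarrow> 'a"

abbreviation arrows :: "('a, 'm) top_groupoid_scheme \<Rightarrow> 'a set" where
  "arrows G \<equiv> topspace (gtop G)"

definition src :: "('a, 'm) top_groupoid_scheme \<Rightarrow> 'a \<Rightarrow> 'a" where
  "src G \<gamma> = gmult G (ginv G \<gamma>) \<gamma>"

definition rng :: "('a, 'm) top_groupoid_scheme \<Rightarrow> 'a \<Rightarrow> 'a" where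
  "rng G \<gamma> = gmult G \<gamma> (ginv G \<gamma>)"

definition units :: "('a, 'm) top_groupoid_scheme \<Rightarrow> 'a set" where
  "units G = src G ` arrows G"

definition unit_top :: "('a, 'm) top_groupoid_scheme \<Rightarrow> 'a topology" where
  "unit_top G = subtopology (gtop G) (units G)"

definition set_mult :: "('a, 'm) top_groupoid_scheme \<Rightarrow> 'a set \<Rightarrow> 'a set \<Rightarrow> 'a set" where
  "set_mult G A B = {gmult G \<alpha> \<beta> | \<alpha> \<beta>. \<alpha> \<in> A \<and> \<beta> \<in> B \<and> (\<alpha>, \<beta>) \<in> comps G}"

text \<open>
  The axioms below are the usual ones in terms of composable pairs; that \<open>(\<alpha>, \<beta>)\<close> is composable
  iff \<open>src G \<alpha> = rng G \<beta>\<close> is a consequence, proved below.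
\<close>

locale algebraic_groupoid =
  fixes G :: "('a, 'm) top_groupoid_scheme"
  assumes comps_subset: "comps G \<subseteq> arrows G \<times> arrows G"
    and mult_closed: "(\<alpha>, \<beta>) \<in> comps G \<Longrightarrow> gmult G \<alpha> \<beta> \<in> arrows G"
    and inv_closed: "\<gamma> \<in> arrows G \<Longrightarrow> ginv G \<gamma> \<in> arrows G"
    and inv_inv: "\<gamma> \<in> arrows G \<Longrightarrow> ginv G (ginv G \<gamma>) = \<gamma>"
    and comps_mult_left: "(\<alpha>, \<beta>) \<in> comps G \<Longrightarrow> (\<beta>, \<gamma>) \<in> comps G \<Longrightarrow> (gmult G \<alpha> \<beta>, \<gamma>) \<in> comps G"
    and comps_mult_right: "(\<alpha>, \<beta>) \<in> comps G \<Longrightarrow> (\<beta>, \<gamma>) \<in> comps G \<Longrightarrow> (\<alpha>, gmult G \<beta> \<gamma>) \<in> comps G"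
    and mult_assoc: "(\<alpha>, \<beta>) \<in> comps G \<Longrightarrow> (\<beta>, \<gamma>) \<in> comps G \<Longrightarrow>
      gmult G (gmult G \<alpha> \<beta>) \<gamma> = gmult G \<alpha> (gmult G \<beta> \<gamma>)"
    and comps_inv: "\<gamma> \<in> arrows G \<Longrightarrow> (\<gamma>, ginv G \<gamma>) \<in> comps G"
    and cancel_left: "(\<gamma>, \<eta>) \<in> comps G \<Longrightarrow> gmult G (ginv G \<gamma>) (gmult G \<gamma> \<eta>) = \<eta>"
    and cancel_right: "(\<gamma>, \<eta>) \<in> comps G \<Longrightarrow> gmult G (gmult G \<gamma> \<eta>) (ginv G \<eta>) = \<gamma>"

locale topological_groupoid = algebraic_groupoid +
  assumes continuous_mult:
      "continuous_map (subtopology (prod_topology (gtop G) (gtop G)) (comps G)) (gtop G)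
        (\<lambda>(\<alpha>, \<beta>). gmult G \<alpha> \<beta>)"
    and continuous_inv: "continuous_map (gtop G) (gtop G) (ginv G)"

definition homeomorphic_on_open :: "'a topology \<Rightarrow> 'b topology \<Rightarrow> ('a \<Rightarrow> 'b) \<Rightarrow> 'a set \<Rightarrow> bool" where
  "homeomorphic_on_open X Y f U \<longleftrightarrow>
    openin X U \<and> openin Y (f ` U) \<and>
    homeomorphic_map (subtopology X U) (subtopology Y (f ` U)) f"

definition local_homeomorphism :: "'a topology \<Rightarrow> 'b topology \<Rightarrow> ('a \<Rightarrow> 'b) \<Rightarrow> bool" where
  "local_homeomorphism X Y f \<longleftrightarrow>
    (\<forall>x \<in> topspace X. \<exists>U. x \<in> U \<and> homeomorphic_on_open X Y f U)"

text \<open>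
  Taking the unit space as codomain makes it open in the arrow space: if \<open>rng G\<close> is injective on
  an open \<open>U\<close> containing a unit, then \<open>U \<inter> (rng G)\<inverse> (U \<inter> units G)\<close> consists of units. Thus the
  definition agrees with the one asking for a local homeomorphism of the arrow space into itself,
  and via inversion \<open>src G\<close> is a local homeomorphism as well.
\<close>

locale etale_groupoid = topological_groupoid +
  assumes local_homeomorphism_rng: "local_homeomorphism (gtop G) (unit_top G) (rng G)"

definition open_bisection :: "('a, 'm) top_groupoid_scheme \<Rightarrow> 'a set \<Rightarrow> bool" where
  "open_bisection G U \<longleftrightarrow>
    homeomorphic_on_open (gtop G) (unit_top G) (src G) U \<and>
    homeomorphic_on_open (gtop G) (unit_top G) (rng G) U"

definition compact_open_bisection :: "('a, 'm) top_groupoid_scheme \<Rightarrow> 'a set \<Rightarrow> bool" where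
  "compact_open_bisection G U \<longleftrightarrow> compactin (gtop G) U \<and> open_bisection G U"

definition ample :: "('a, 'm) top_groupoid_scheme \<Rightarrow> bool" where
  "ample G \<longleftrightarrow> openin (gtop G) = arbitrary union_of (compact_open_bisection G)"

definition invariant_set :: "('a, 'm) top_groupoid_scheme \<Rightarrow> 'a set \<Rightarrow> bool" where
  "invariant_set G D \<longleftrightarrow> D \<subseteq> units G \<and> rng G ` set_mult G (arrows G) D = D"

definition minimal_groupoid :: "('a, 'm) top_groupoid_scheme \<Rightarrow> bool" where
  "minimal_groupoid G \<longleftrightarrow>
    \<not> (\<exists>D. closedin (unit_top G) D \<and> invariant_set G D \<and> D \<noteq> {} \<and> D \<noteq> units G)"

text \<open>The relation \<open>K \<prec> V\<close> for compact \<open>K\<close>, then \<open>U \<prec> V\<close> and \<open>U \<prec>\<^sub>2 V\<close> for open \<open>U\<close>.\<close>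

definition compact_subeq :: "('a, 'm) top_groupoid_scheme \<Rightarrow> 'a set \<Rightarrow> 'a set \<Rightarrow> bool" where
  "compact_subeq G K V \<longleftrightarrow>
    (\<exists>(n::nat) A. (\<forall>i<n. open_bisection G (A i)) \<and>
      K \<subseteq> (\<Union>i<n. src G ` A i) \<and>
      (\<forall>i<n. rng G ` A i \<subseteq> V) \<and>
      disjoint_family_on (\<lambda>i. rng G ` A i) {..<n})"

definition open_subeq :: "('a, 'm) top_groupoid_scheme \<Rightarrow> 'a set \<Rightarrow> 'a set \<Rightarrow> bool" where
  "open_subeq G U V \<longleftrightarrow>
    (\<forall>K. compactin (unit_top G) K \<and> K \<subseteq> U \<longrightarrow> compact_subeq G K V)"

definition open_subeq2 :: "('a, 'm) top_groupoid_scheme \<Rightarrow> 'a set \<Rightarrow> 'a set \<Rightarrow> bool" where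
  "open_subeq2 G U V \<longleftrightarrow>
    (\<forall>F. compactin (unit_top G) F \<and> F \<subseteq> U \<longrightarrow>
      (\<exists>O\<^sub>1 O\<^sub>2. openin (unit_top G) O\<^sub>1 \<and> openin (unit_top G) O\<^sub>2 \<and>
        O\<^sub>1 \<noteq> {} \<and> O\<^sub>2 \<noteq> {} \<and> O\<^sub>1 \<inter> O\<^sub>2 = {} \<and> O\<^sub>1 \<subseteq> V \<and> O\<^sub>2 \<subseteq> V \<and>
        compact_subeq G F O\<^sub>1 \<and> compact_subeq G F O\<^sub>2))"

definition borel_on :: "'a topology \<Rightarrow> 'a measure" where
  "borel_on X = sigma (topspace X) {U. openin X U}"

text \<open>
  Regular means outer regular by open sets and inner regular by compact sets on every Borel set.
  The side condition \<open>K \<in> sets \<mu>\<close> is automatic in Hausdorff spaces.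
\<close>

definition regular_measure_on :: "'a topology \<Rightarrow> 'a measure \<Rightarrow> bool" where
  "regular_measure_on X \<mu> \<longleftrightarrow>
    (\<forall>A \<in> sets \<mu>.
      emeasure \<mu> A = (INF U \<in> {U. openin X U \<and> A \<subseteq> U}. emeasure \<mu> U) \<and>
      emeasure \<mu> A = (SUP K \<in> {K. compactin X K \<and> K \<in> sets \<mu> \<and> K \<subseteq> A}. emeasure \<mu> K))"

definition invariant_prob_measures :: "('a, 'm) top_groupoid_scheme \<Rightarrow> 'a measure set" where
  "invariant_prob_measures G =
    {\<mu>. prob_space \<mu> \<and> sets \<mu> = sets (borel_on (unit_top G)) \<and>
        regular_measure_on (unit_top G) \<mu> \<and>
        (\<forall>U. open_bisection G U \<longrightarrow> measure \<mu> (rng G ` U) = measure \<mu> (src G ` U))}"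

definition groupoid_comparison :: "('a, 'm) top_groupoid_scheme \<Rightarrow> bool" where
  "groupoid_comparison G \<longleftrightarrow>
    (\<forall>U V. openin (unit_top G) U \<and> openin (unit_top G) V \<and> V \<noteq> {} \<and>
      (\<forall>\<mu> \<in> invariant_prob_measures G. measure \<mu> U < measure \<mu> V) \<longrightarrow> open_subeq G U V)"

definition purely_infinite :: "('a, 'm) top_groupoid_scheme \<Rightarrow> bool" where
  "purely_infinite G \<longleftrightarrow>
    (\<forall>O\<^sub>1 O\<^sub>2. openin (unit_top G) O\<^sub>1 \<and> openin (unit_top G) O\<^sub>2 \<and> O\<^sub>1 \<noteq> {} \<and> O\<^sub>2 \<noteq> {} \<and>
      O\<^sub>1 \<subseteq> rng G ` set_mult G (arrows G) O\<^sub>2 \<longrightarrow> open_subeq2 G O\<^sub>1 O\<^sub>2)"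

text \<open>The definition below also ranges over \<open>S = {}\<close>, where empty bisections are witnesses.\<close>

definition purely_infinite_Matui :: "('a, 'm) top_groupoid_scheme \<Rightarrow> bool" where
  "purely_infinite_Matui G \<longleftrightarrow>
    (\<forall>S. compactin (unit_top G) S \<and> openin (unit_top G) S \<longrightarrow>
      (\<exists>U V. compact_open_bisection G U \<and> compact_open_bisection G V \<and>
        src G ` U = S \<and> src G ` V = S \<and>
        rng G ` U \<inter> rng G ` V = {} \<and> rng G ` U \<union> rng G ` V \<subseteq> S))"

definition n_filling :: "nat \<Rightarrow> ('a, 'm) top_groupoid_scheme \<Rightarrow> bool" where
  "n_filling n G \<longleftrightarrow>
    (\<forall>W. openin (unit_top G) W \<and> W \<noteq> {} \<longrightarrow>
      (\<exists>E. (\<forall>i<n. open_bisection G (E i)) \<and> (\<Union>i<n. rng G ` set_mult G (E i) W) = units G))"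

definition locally_contracting :: "('a, 'm) top_groupoid_scheme \<Rightarrow> bool" where
  "locally_contracting G \<longleftrightarrow>
    (\<forall>U. openin (unit_top G) U \<and> U \<noteq> {} \<longrightarrow>
      (\<exists>V B. openin (unit_top G) V \<and> V \<subseteq> U \<and> open_bisection G B \<and>
        unit_top G closure_of V \<subseteq> src G ` B \<and>
        rng G ` set_mult G B (unit_top G closure_of V) \<subset> V))"

context algebraic_groupoid
begin

lemma comps_inv_left: "\<gamma> \<in> arrows G \<Longrightarrow> (ginv G \<gamma>, \<gamma>) \<in> comps G"
  using comps_inv inv_closed inv_inv by metis

lemma rng_mult_left:
  assumes "\<beta> \<in> arrows G"
  shows "(rng G \<beta>, \<beta>) \<in> comps G" "gmult G (rng G \<beta>) \<beta> = \<beta>"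
proof -
  show "(rng G \<beta>, \<beta>) \<in> comps G"
    unfolding rng_def using comps_inv comps_inv_left comps_mult_left assms by blast
  show "gmult G (rng G \<beta>) \<beta> = \<beta>"
    unfolding rng_def using cancel_right[OF comps_inv[OF assms]] inv_inv[OF assms] by simp
qed

lemma src_mult_right:
  assumes "\<alpha> \<in> arrows G"
  shows "(\<alpha>, src G \<alpha>) \<in> comps G" "gmult G \<alpha> (src G \<alpha>) = \<alpha>"
proof -
  show "(\<alpha>, src G \<alpha>) \<in> comps G"
    unfolding src_def using comps_inv comps_inv_left comps_mult_right assms by blast
  show "gmult G \<alpha> (src G \<alpha>) = \<alpha>"
    unfolding src_def using cancel_left[OF comps_inv_left[OF assms]] inv_inv[OF assms] by simp
qed

lemma comps_iff:
  assumes "\<alpha> \<in> arrows G" "\<beta> \<in> arrows G"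
  shows "(\<alpha>, \<beta>) \<in> comps G \<longleftrightarrow> src G \<alpha> = rng G \<beta>"
proof
  assume c: "(\<alpha>, \<beta>) \<in> comps G"
  have "src G \<alpha> = gmult G (ginv G \<alpha>) (gmult G (gmult G \<alpha> \<beta>) (ginv G \<beta>))"
    using cancel_right[OF c] by (simp add: src_def)
  also have "\<dots> = gmult G (ginv G \<alpha>) (gmult G \<alpha> (gmult G \<beta> (ginv G \<beta>)))"
    using mult_assoc[OF c comps_inv[OF assms(2)]] by simp
  also have "\<dots> = rng G \<beta>"
    using cancel_left[OF comps_mult_right[OF c comps_inv[OF assms(2)]]] by (simp add: rng_def)
  finally show "src G \<alpha> = rng G \<beta>" .
next
  assume e: "src G \<alpha> = rng G \<beta>"
  show "(\<alpha>, \<beta>) \<in> comps G"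
    using comps_mult_left[of \<alpha> "src G \<alpha>" \<beta>] src_mult_right[OF assms(1)] rng_mult_left[OF assms(2)] e
    by simp
qed

lemma arrows_set_mult:
  assumes "D \<subseteq> units G"
  shows "set_mult G (arrows G) D = {\<gamma> \<in> arrows G. src G \<gamma> \<in> D}"
proof (intro equalityI subsetI)
  fix \<gamma> assume "\<gamma> \<in> set_mult G (arrows G) D"
  then obtain \<alpha> \<beta> where h: "\<gamma> = gmult G \<alpha> \<beta>" "\<beta> \<in> D" "(\<alpha>, \<beta>) \<in> comps G"
    by (auto simp: set_mult_def)
  then obtain \<delta> where \<delta>: "\<delta> \<in> arrows G" "\<beta> = src G \<delta>"
    using assms by (auto simp: units_def)
  have a: "\<alpha> \<in> arrows G" "\<beta> \<in> arrows G"
    using h comps_subset by auto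
  have "rng G \<beta> = src G \<delta>"
    using comps_iff[OF \<delta>(1) a(2)] src_mult_right[OF \<delta>(1)] \<delta>(2) by simp
  then have "src G \<alpha> = \<beta>"
    using comps_iff[OF a] h(3) \<delta>(2) by simp
  then show "\<gamma> \<in> {\<gamma> \<in> arrows G. src G \<gamma> \<in> D}"
    using h a src_mult_right[OF a(1)] by simp
next
  fix \<gamma> assume "\<gamma> \<in> {\<gamma> \<in> arrows G. src G \<gamma> \<in> D}"
  then show "\<gamma> \<in> set_mult G (arrows G) D"
    unfolding set_mult_def using src_mult_right[of \<gamma>] by force
qed

end

end

(* All five properties are equivalent to the condition that the whole unit space X is subequivalent
   to every non-empty open set V. Since X is compact and totally disconnected, this subequivalence is
   realised by a single bisection E with s(E) = X and r(E) contained in V; its inverse shows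
   1-filling. Since X has no isolated points, V contains two disjoint non-empty open sets, which gives
   pure infiniteness (also in Matui's sense) and rules out invariant probability measures. Conversely,
   in Matui's case the finitely many bisections that move X into a compact open subset S of V are made
   disjoint by composing them with disjoint copies of S inside S. *)

theory Submission imports Defs begin

text \<open>Minimality enters through a single fact: the saturation of a non-empty open set is the
  whole unit space. Hence every unit is carried by a bisection into any prescribed non-empty open
  set, and the hypothesis on the two sets in the definition of pure infiniteness always holds.
  Bisections obtained this way have unrelated ranges, so the obstacle is to make ranges disjoint.
  Overlapping sources are harmless: where sources are compact open, overlaps can be cut away without
  losing openness. For filling, disjointness is arranged in advance by choosing disjoint targets
  inside V and then filling from a set that can be moved into all of them. Invariant measures are
  excluded because each of two disjoint open sets would have full mass; with no measures left, the
  numerical hypothesis of comparison is vacuous. Local contraction comes from Matui's pair: the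
  second range occupies room that the first one cannot fill.\<close>

section \<open>Local homeomorphisms are continuous and open\<close>

lemma local_homeomorphism_imp_continuous_map:
  assumes "local_homeomorphism X Y f"
  shows "continuous_map X Y f"
  unfolding continuous_map_def
proof (intro conjI allI impI)
  show "f \<in> topspace X \<rightarrow> topspace Y"
    using assms openin_subset unfolding local_homeomorphism_def homeomorphic_on_open_def by blast
  fix W assume W: "openin Y W"
  show "openin X {x \<in> topspace X. f x \<in> W}"
  proof (subst openin_subopen, intro ballI)
    fix x assume "x \<in> {x \<in> topspace X. f x \<in> W}"
    then obtain U where U: "x \<in> U" "openin X U" "f x \<in> W"
      "homeomorphic_map (subtopology X U) (subtopology Y (f ` U)) f"
      using assms unfolding local_homeomorphism_def homeomorphic_on_open_def by blast
    have "continuous_map (subtopology X U) Y f"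
      using homeomorphic_imp_continuous_map[OF U(4)] by (simp add: continuous_map_in_subtopology)
    then have "openin (subtopology X U) {z \<in> topspace (subtopology X U). f z \<in> W}"
      using W openin_continuous_map_preimage by blast
    then have "openin X {z \<in> topspace (subtopology X U). f z \<in> W}"
      using U(2) openin_trans_full by blast
    then show "\<exists>T. openin X T \<and> x \<in> T \<and> T \<subseteq> {x \<in> topspace X. f x \<in> W}"
      using U openin_subset[OF U(2)]
      by (intro exI[of _ "{z \<in> topspace (subtopology X U). f z \<in> W}"]) auto
  qed
qed

lemma local_homeomorphism_imp_open_map:
  assumes "local_homeomorphism X Y f"
  shows "open_map X Y f"
  unfolding open_map_def
proof (intro allI impI)
  fix W assume W: "openin X W"
  show "openin Y (f ` W)"
  proof (subst openin_subopen, intro ballI)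
    fix y assume "y \<in> f ` W"
    then obtain x where x: "x \<in> W" "y = f x" by auto
    then obtain U where U: "x \<in> U" "openin X U" "openin Y (f ` U)"
      "homeomorphic_map (subtopology X U) (subtopology Y (f ` U)) f"
      using assms openin_subset[OF W] unfolding local_homeomorphism_def homeomorphic_on_open_def by blast
    have "openin (subtopology X U) (W \<inter> U)"
      using W by (simp add: openin_subtopology_Int)
    then have "openin (subtopology Y (f ` U)) (f ` (W \<inter> U))"
      using U(4) homeomorphic_imp_open_map open_map_def by blast
    then have "openin Y (f ` (W \<inter> U))"
      using U(3) openin_trans_full by blast
    then show "\<exists>T. openin Y T \<and> y \<in> T \<and> T \<subseteq> f ` W"
      using x U(1) by (intro exI[of _ "f ` (W \<inter> U)"]) auto
  qed
qed

section \<open>Source, range and products of sets of arrows\<close>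

context algebraic_groupoid
begin

lemma src_inv: "\<gamma> \<in> arrows G \<Longrightarrow> src G (ginv G \<gamma>) = rng G \<gamma>"
  by (simp add: src_def rng_def inv_inv)

lemma rng_inv: "\<gamma> \<in> arrows G \<Longrightarrow> rng G (ginv G \<gamma>) = src G \<gamma>"
  by (simp add: src_def rng_def inv_inv)

lemma src_in_units: "\<gamma> \<in> arrows G \<Longrightarrow> src G \<gamma> \<in> units G"
  by (simp add: units_def)

lemma rng_in_units: "\<gamma> \<in> arrows G \<Longrightarrow> rng G \<gamma> \<in> units G"
  by (metis src_in_units src_inv inv_closed)

lemma units_subset_arrows: "units G \<subseteq> arrows G"
  unfolding units_def using src_mult_right(1) comps_subset by blast

lemma src_mult:
  assumes "(\<alpha>, \<beta>) \<in> comps G"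
  shows "src G (gmult G \<alpha> \<beta>) = src G \<beta>"
proof -
  have a: "\<alpha> \<in> arrows G" "\<beta> \<in> arrows G" using assms comps_subset by auto
  have "(gmult G \<alpha> \<beta>, src G \<beta>) \<in> comps G"
    using comps_mult_left[OF assms] src_mult_right(1)[OF a(2)] by blast
  moreover have "(\<beta>, src G \<beta>) \<in> comps G" using src_mult_right(1)[OF a(2)] .
  moreover have "src G \<beta> \<in> arrows G" using units_subset_arrows src_in_units a by blast
  ultimately show ?thesis
    using comps_iff mult_closed[OF assms] a by metis
qed

lemma rng_mult:
  assumes "(\<alpha>, \<beta>) \<in> comps G"
  shows "rng G (gmult G \<alpha> \<beta>) = rng G \<alpha>"
proof -
  have a: "\<alpha> \<in> arrows G" "\<beta> \<in> arrows G" using assms comps_subset by auto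
  have "(rng G \<alpha>, gmult G \<alpha> \<beta>) \<in> comps G"
    using comps_mult_right[OF _ assms] rng_mult_left(1)[OF a(1)] by blast
  moreover have "(rng G \<alpha>, \<alpha>) \<in> comps G" using rng_mult_left(1)[OF a(1)] .
  moreover have "rng G \<alpha> \<in> arrows G" using units_subset_arrows rng_in_units a by blast
  ultimately show ?thesis
    using comps_iff mult_closed[OF assms] a by metis
qed

lemma rng_unit:
  assumes "u \<in> units G"
  shows "rng G u = u"
proof -
  obtain \<delta> where d: "\<delta> \<in> arrows G" "u = src G \<delta>" using assms by (auto simp: units_def)
  have "u \<in> arrows G" using assms units_subset_arrows by auto
  then show ?thesis using comps_iff[OF d(1), of u] src_mult_right[OF d(1)] d by simp
qed

lemma src_unit:
  assumes "u \<in> units G"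
  shows "src G u = u"
proof -
  obtain \<delta> where d: "\<delta> \<in> arrows G" "u = src G \<delta>" using assms by (auto simp: units_def)
  then show ?thesis using src_mult[OF src_mult_right(1)[OF d(1)]] src_mult_right(2)[OF d(1)] by simp
qed

text \<open>The only unit composable on the right of an arrow is its source, and multiplying by it
  changes nothing. This turns the products in the definitions of filling and contraction into
  restrictions.\<close>

lemma set_mult_units:
  assumes "A \<subseteq> arrows G" "D \<subseteq> units G"
  shows "set_mult G A D = {\<gamma> \<in> A. src G \<gamma> \<in> D}"
proof (intro equalityI subsetI)
  fix \<gamma> assume "\<gamma> \<in> set_mult G A D"
  then obtain \<alpha> \<beta> where h: "\<gamma> = gmult G \<alpha> \<beta>" "\<alpha> \<in> A" "\<beta> \<in> D" "(\<alpha>, \<beta>) \<in> comps G"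
    by (auto simp: set_mult_def)
  then have a: "\<alpha> \<in> arrows G" "\<beta> \<in> arrows G"
    using comps_subset by auto
  then have "src G \<alpha> = \<beta>"
    using comps_iff h rng_unit assms by (metis subsetD)
  then show "\<gamma> \<in> {\<gamma> \<in> A. src G \<gamma> \<in> D}"
    using h a src_mult_right[OF a(1)] by simp
next
  fix \<gamma> assume "\<gamma> \<in> {\<gamma> \<in> A. src G \<gamma> \<in> D}"
  then show "\<gamma> \<in> set_mult G A D"
    unfolding set_mult_def using src_mult_right[of \<gamma>] assms by force
qed

lemma src_inv_image: "A \<subseteq> arrows G \<Longrightarrow> src G ` ginv G ` A = rng G ` A"
  using src_inv by (force simp: image_image)

lemma rng_inv_image: "A \<subseteq> arrows G \<Longrightarrow> rng G ` ginv G ` A = src G ` A"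
  using rng_inv by (force simp: image_image)

text \<open>The inclusion of ranges in sources gives every arrow of \<open>B\<close> a partner in
  \<open>A\<close>, so no source is lost. This is how bisections are moved into a new target while
  still covering the same units.\<close>

lemma set_mult_src_rng:
  assumes "A \<subseteq> arrows G" "B \<subseteq> arrows G" "rng G ` B \<subseteq> src G ` A"
  shows "src G ` set_mult G A B = src G ` B" "rng G ` set_mult G A B \<subseteq> rng G ` A"
proof -
  show "rng G ` set_mult G A B \<subseteq> rng G ` A"
    by (auto simp: set_mult_def rng_mult)
  show "src G ` set_mult G A B = src G ` B"
  proof (intro equalityI subsetI)
    fix x assume "x \<in> src G ` B"
    then obtain b where b: "b \<in> B" "x = src G b" by auto
    then obtain a where a: "a \<in> A" "src G a = rng G b" using assms(3) by force
    then have c: "(a, b) \<in> comps G" using comps_iff b assms by blast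
    then have "gmult G a b \<in> set_mult G A B" using a b by (auto simp: set_mult_def)
    then show "x \<in> src G ` set_mult G A B" using src_mult[OF c] b(2) by (metis image_eqI)
  qed (auto simp: set_mult_def src_mult)
qed

end

section \<open>Topology of source and range; calculus of open bisections\<close>

lemma (in topological_groupoid) homeomorphic_map_inv: "homeomorphic_map (gtop G) (gtop G) (ginv G)"
  by (rule homeomorphic_maps_imp_map[of _ _ _ "ginv G"])
     (simp add: homeomorphic_maps_def continuous_inv inv_inv)

context etale_groupoid
begin

lemma topspace_unit_top: "topspace (unit_top G) = units G"
  using units_subset_arrows by (auto simp: unit_top_def)

lemma continuous_rng: "continuous_map (gtop G) (unit_top G) (rng G)"
  by (rule local_homeomorphism_imp_continuous_map[OF local_homeomorphism_rng])

lemma open_rng: "open_map (gtop G) (unit_top G) (rng G)"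
  by (rule local_homeomorphism_imp_open_map[OF local_homeomorphism_rng])

lemma continuous_src: "continuous_map (gtop G) (unit_top G) (src G)"
proof -
  have "continuous_map (gtop G) (unit_top G) (rng G \<circ> ginv G)"
    using continuous_map_compose[OF continuous_inv continuous_rng] .
  then show ?thesis by (rule continuous_map_eq) (simp add: rng_inv)
qed

lemma open_src: "open_map (gtop G) (unit_top G) (src G)"
proof -
  have "open_map (gtop G) (unit_top G) (rng G \<circ> ginv G)"
    using open_map_compose[OF homeomorphic_imp_open_map[OF homeomorphic_map_inv] open_rng] .
  then show ?thesis by (rule open_map_eq) (simp add: rng_inv)
qed

text \<open>Source and range are continuous and open, so injectivity on an open set already makes
  them homeomorphisms onto open images. From here on a bisection is an open set with two injectivity
  conditions.\<close>

lemma open_bisection_iff: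
  "open_bisection G U \<longleftrightarrow> openin (gtop G) U \<and> inj_on (src G) U \<and> inj_on (rng G) U"
proof -
  have *: "homeomorphic_on_open (gtop G) (unit_top G) f U \<longleftrightarrow> openin (gtop G) U \<and> inj_on f U"
    if f: "continuous_map (gtop G) (unit_top G) f" "open_map (gtop G) (unit_top G) f" for f
  proof
    assume h: "homeomorphic_on_open (gtop G) (unit_top G) f U"
    then have "openin (gtop G) U" by (simp add: homeomorphic_on_open_def)
    moreover have "inj_on f (topspace (subtopology (gtop G) U))"
      using h homeomorphic_imp_injective_map unfolding homeomorphic_on_open_def by blast
    ultimately show "openin (gtop G) U \<and> inj_on f U"
      using openin_subset by (metis topspace_subtopology_subset)
  next
    assume h: "openin (gtop G) U \<and> inj_on f U"
    then have U: "U \<subseteq> arrows G" using openin_subset by auto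
    have fU: "openin (unit_top G) (f ` U)" using f(2) h open_map_def by blast
    have "homeomorphic_map (subtopology (gtop G) U) (subtopology (unit_top G) (f ` U)) f"
    proof (rule bijective_open_imp_homeomorphic_map)
      show "continuous_map (subtopology (gtop G) U) (subtopology (unit_top G) (f ` U)) f"
        using f(1) by (auto simp: continuous_map_in_subtopology intro: continuous_map_from_subtopology)
      show "open_map (subtopology (gtop G) U) (subtopology (unit_top G) (f ` U)) f"
        unfolding open_map_def
      proof (intro allI impI)
        fix W assume "openin (subtopology (gtop G) U) W"
        then have "openin (gtop G) W" "W \<subseteq> U"
          using h openin_open_subtopology by blast+
        then show "openin (subtopology (unit_top G) (f ` U)) (f ` W)"
          using f(2) fU by (auto simp: openin_open_subtopology open_map_def)
      qed
      show "f ` topspace (subtopology (gtop G) U) = topspace (subtopology (unit_top G) (f ` U))"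
        using U openin_subset[OF fU] by (simp add: Int_absorb1)
      show "inj_on f (topspace (subtopology (gtop G) U))"
        using U h by (simp add: Int_absorb1)
    qed
    then show "homeomorphic_on_open (gtop G) (unit_top G) f U"
      using h fU by (simp add: homeomorphic_on_open_def)
  qed
  show ?thesis
    unfolding open_bisection_def
    using *[OF continuous_src open_src] *[OF continuous_rng open_rng] by blast
qed

lemma open_bisection_subset: "open_bisection G U \<Longrightarrow> U \<subseteq> arrows G"
  by (simp add: open_bisection_iff openin_subset)

lemma openin_src_image: "openin (gtop G) U \<Longrightarrow> openin (unit_top G) (src G ` U)"
  using open_src open_map_def by blast

lemma openin_rng_image: "openin (gtop G) U \<Longrightarrow> openin (unit_top G) (rng G ` U)"
  using open_rng open_map_def by blast

lemma openin_restrict_src: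
  assumes "openin (gtop G) U" "openin (unit_top G) V"
  shows "openin (gtop G) {\<gamma> \<in> U. src G \<gamma> \<in> V}"
proof -
  have "{\<gamma> \<in> U. src G \<gamma> \<in> V} = U \<inter> {\<gamma> \<in> arrows G. src G \<gamma> \<in> V}"
    using openin_subset[OF assms(1)] by auto
  then show ?thesis using assms openin_continuous_map_preimage[OF continuous_src] by auto
qed

lemma openin_restrict_rng:
  assumes "openin (gtop G) U" "openin (unit_top G) V"
  shows "openin (gtop G) {\<gamma> \<in> U. rng G \<gamma> \<in> V}"
proof -
  have "{\<gamma> \<in> U. rng G \<gamma> \<in> V} = U \<inter> {\<gamma> \<in> arrows G. rng G \<gamma> \<in> V}"
    using openin_subset[OF assms(1)] by auto
  then show ?thesis using assms openin_continuous_map_preimage[OF continuous_rng] by auto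
qed

lemma open_bisection_restrict_src:
  assumes "open_bisection G U" "openin (unit_top G) V"
  shows "open_bisection G {\<gamma> \<in> U. src G \<gamma> \<in> V}"
  using assms openin_restrict_src by (auto simp: open_bisection_iff inj_on_def)

lemma open_bisection_restrict_rng:
  assumes "open_bisection G U" "openin (unit_top G) V"
  shows "open_bisection G {\<gamma> \<in> U. rng G \<gamma> \<in> V}"
  using assms openin_restrict_rng by (auto simp: open_bisection_iff inj_on_def)

lemma open_bisection_inv:
  assumes "open_bisection G U"
  shows "open_bisection G (ginv G ` U)"
proof -
  have U: "U \<subseteq> arrows G" using open_bisection_subset[OF assms] .
  have "openin (gtop G) (ginv G ` U)"
    using assms homeomorphic_imp_open_map[OF homeomorphic_map_inv]
    by (auto simp: open_bisection_iff open_map_def)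
  moreover have "inj_on (src G) (ginv G ` U)" "inj_on (rng G) (ginv G ` U)"
    using assms U src_inv rng_inv by (auto simp: open_bisection_iff inj_on_def subset_iff)
  ultimately show ?thesis by (simp add: open_bisection_iff)
qed

text \<open>A bisection is homeomorphic to its source. This supplies the compactness that Matui's
  condition demands of bisections built merely as open ones.\<close>

lemma compactin_open_bisection:
  assumes "open_bisection G U" "compactin (unit_top G) (src G ` U)"
  shows "compactin (gtop G) U"
proof -
  have h: "homeomorphic_map (subtopology (gtop G) U) (subtopology (unit_top G) (src G ` U)) (src G)"
    using assms(1) by (simp add: open_bisection_def homeomorphic_on_open_def)
  have "compact_space (subtopology (unit_top G) (src G ` U))"
    using assms(2) compactin_subspace by blast
  then have "compact_space (subtopology (gtop G) U)"
    using h homeomorphic_compact_space homeomorphic_map_imp_homeomorphic_space by blast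
  then show ?thesis using open_bisection_subset[OF assms(1)] compactin_subspace by blast
qed

text \<open>An arrow \<open>\<delta>\<close> lies in \<open>AB\<close> iff \<open>src \<delta> \<in> src B\<close> and \<open>\<delta> \<sigma>(src \<delta>)\<inverse> \<in> A\<close>, where \<open>\<sigma>\<close> is the
  continuous section of the source map onto \<open>B\<close>; this is an open condition on \<open>\<delta>\<close>.\<close>

lemma open_bisection_mult:
  assumes A: "open_bisection G A" and B: "open_bisection G B"
  shows "open_bisection G (set_mult G A B)"
proof -
  have Aa: "A \<subseteq> arrows G" and Ba: "B \<subseteq> arrows G"
    using A B open_bisection_subset by auto
  obtain \<sigma> where sg: "homeomorphic_maps (subtopology (gtop G) B) (subtopology (unit_top G) (src G ` B)) (src G) \<sigma>"
    using B unfolding open_bisection_def homeomorphic_on_open_def homeomorphic_map_maps by blast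
  have sB: "openin (unit_top G) (src G ` B)"
    using B openin_src_image by (simp add: open_bisection_iff)
  have \<sigma>src: "\<sigma> (src G b) = b" if "b \<in> B" for b
    using sg that Ba by (auto simp: homeomorphic_maps_def)
  define T where "T = {\<delta> \<in> arrows G. src G \<delta> \<in> src G ` B}"
  have T: "openin (gtop G) T"
    unfolding T_def using openin_restrict_src[OF openin_topspace sB] .
  define f where "f = (\<lambda>\<delta>. gmult G \<delta> (ginv G (\<sigma> (src G \<delta>))))"
  have \<sigma>T: "\<sigma> (src G \<delta>) \<in> B \<and> src G (\<sigma> (src G \<delta>)) = src G \<delta>" if "\<delta> \<in> T" for \<delta>
    using that \<sigma>src by (auto simp: T_def)
  have comp: "(\<delta>, ginv G (\<sigma> (src G \<delta>))) \<in> comps G" if "\<delta> \<in> T" for \<delta>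
    using \<sigma>T[OF that] that Ba by (subst comps_iff) (auto simp: T_def rng_inv inv_closed)
  have "continuous_map (subtopology (gtop G) T) (subtopology (unit_top G) (src G ` B)) (src G)"
    using continuous_src by (auto simp: continuous_map_in_subtopology T_def intro: continuous_map_from_subtopology)
  moreover have "continuous_map (subtopology (unit_top G) (src G ` B)) (gtop G) \<sigma>"
    using sg by (auto simp: homeomorphic_maps_def continuous_map_in_subtopology)
  ultimately have "continuous_map (subtopology (gtop G) T) (gtop G) (\<sigma> \<circ> src G)"
    by (rule continuous_map_compose)
  then have "continuous_map (subtopology (gtop G) T) (gtop G) (ginv G \<circ> (\<sigma> \<circ> src G))"
    using continuous_map_compose continuous_inv by blast
  then have "continuous_map (subtopology (gtop G) T) (prod_topology (gtop G) (gtop G))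
      (\<lambda>\<delta>. (\<delta>, (ginv G \<circ> (\<sigma> \<circ> src G)) \<delta>))"
    by (intro continuous_map_pairedI) (auto simp: comp_def intro: continuous_map_from_subtopology)
  then have "continuous_map (subtopology (gtop G) T) (subtopology (prod_topology (gtop G) (gtop G)) (comps G))
      (\<lambda>\<delta>. (\<delta>, (ginv G \<circ> (\<sigma> \<circ> src G)) \<delta>))"
    using comp by (auto simp: continuous_map_in_subtopology)
  from continuous_map_compose[OF this continuous_mult]
  have "continuous_map (subtopology (gtop G) T) (gtop G) f"
    by (simp add: f_def comp_def)
  then have "openin (subtopology (gtop G) T) {\<delta> \<in> topspace (subtopology (gtop G) T). f \<delta> \<in> A}"
    using A open_bisection_iff openin_continuous_map_preimage by blast
  then have "openin (gtop G) {\<delta> \<in> T. f \<delta> \<in> A}"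
    using openin_trans_full[OF _ T] openin_subset[OF T] by (simp add: Int_absorb1)
  moreover have "set_mult G A B = {\<delta> \<in> T. f \<delta> \<in> A}"
  proof (intro equalityI subsetI)
    fix \<delta> assume "\<delta> \<in> set_mult G A B"
    then obtain a b where ab: "\<delta> = gmult G a b" "a \<in> A" "b \<in> B" "(a, b) \<in> comps G"
      by (auto simp: set_mult_def)
    then show "\<delta> \<in> {\<delta> \<in> T. f \<delta> \<in> A}"
      using \<sigma>src cancel_right mult_closed src_mult by (auto simp: T_def f_def)
  next
    fix \<delta> assume \<delta>: "\<delta> \<in> {\<delta> \<in> T. f \<delta> \<in> A}"
    then have b: "\<sigma> (src G \<delta>) \<in> B" "\<sigma> (src G \<delta>) \<in> arrows G" using \<sigma>T Ba by auto
    have c: "(\<delta>, ginv G (\<sigma> (src G \<delta>))) \<in> comps G" using \<delta> comp by blast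
    have "gmult G (f \<delta>) (\<sigma> (src G \<delta>)) = \<delta>"
      using cancel_right[OF c] inv_inv[OF b(2)] by (simp add: f_def)
    moreover have "(f \<delta>, \<sigma> (src G \<delta>)) \<in> comps G"
      unfolding f_def using comps_mult_left[OF c comps_inv_left[OF b(2)]] .
    ultimately show "\<delta> \<in> set_mult G A B"
      using \<delta> b unfolding set_mult_def by force
  qed
  moreover have "inj_on (src G) (set_mult G A B)" "inj_on (rng G) (set_mult G A B)"
  proof -
    \<comment> \<open>Equal sources of two products fix the right factors, and composability then
      fixes the left ones; for equal ranges the order is reversed.\<close>
    have eq: "a = a' \<and> b = b'" if "a \<in> A" "a' \<in> A" "b \<in> B" "b' \<in> B" "(a, b) \<in> comps G" "(a', b') \<in> comps G"
      "src G b = src G b' \<or> rng G a = rng G a'" for a a' b b'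
    proof -
      have s: "src G a = rng G b" "src G a' = rng G b'" using that comps_iff Aa Ba by blast+
      show ?thesis using that(7)
      proof
        assume "src G b = src G b'"
        then have "b = b'" using B that by (auto simp: open_bisection_iff inj_on_def)
        then show ?thesis using s A that by (auto simp: open_bisection_iff inj_on_def)
      next
        assume "rng G a = rng G a'"
        then have "a = a'" using A that by (auto simp: open_bisection_iff inj_on_def)
        then show ?thesis using s B that by (auto simp: open_bisection_iff inj_on_def)
      qed
    qed
    show "inj_on (src G) (set_mult G A B)"
      using eq by (auto simp: inj_on_def set_mult_def src_mult) blast
    show "inj_on (rng G) (set_mult G A B)"
      using eq by (auto simp: inj_on_def set_mult_def rng_mult) blast
  qed
  ultimately show ?thesis by (simp add: open_bisection_iff)
qed

end

section \<open>Compact open sets and sections of the source map\<close>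

locale minimal_ample_groupoid = etale_groupoid +
  assumes Hausdorff: "Hausdorff_space (gtop G)"
    and ample: "ample G"
    and minimal: "minimal_groupoid G"
    and compact: "compact_space (unit_top G)"
    and infinite: "infinite (units G)"
begin

lemma Hausdorff_unit_top: "Hausdorff_space (unit_top G)"
  unfolding unit_top_def using Hausdorff Hausdorff_space_subtopology by blast

lemma openin_units: "openin (unit_top G) (units G)"
  using openin_topspace[of "unit_top G"] by (simp add: topspace_unit_top)

lemma compactin_units: "compactin (unit_top G) (units G)"
  using compact by (simp add: compact_space_def topspace_unit_top)

lemma units_nonempty: "units G \<noteq> {}"
  using infinite by auto

lemma ex_compact_open_bisection:
  assumes "openin (gtop G) U" "\<gamma> \<in> U"
  obtains C where "compact_open_bisection G C" "\<gamma> \<in> C" "C \<subseteq> U"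
  using assms ample unfolding ample_def union_of_def by auto

text \<open>The basis of the arrow space is carried to the unit space by the source map, which is
  continuous and open and fixes \<open>x\<close>.\<close>

lemma ex_compact_open:
  assumes "openin (unit_top G) V" "x \<in> V"
  obtains S where "compactin (unit_top G) S" "openin (unit_top G) S" "x \<in> S" "S \<subseteq> V"
proof -
  have x: "x \<in> units G" using assms openin_subset topspace_unit_top by blast
  then have x': "x \<in> {\<gamma> \<in> arrows G. src G \<gamma> \<in> V}"
    using assms(2) units_subset_arrows src_unit by auto
  obtain C where C: "compact_open_bisection G C" "x \<in> C" "C \<subseteq> {\<gamma> \<in> arrows G. src G \<gamma> \<in> V}"
    using ex_compact_open_bisection[OF openin_restrict_src[OF openin_topspace assms(1)] x'] .
  show thesis
  proof
    show "compactin (unit_top G) (src G ` C)"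
      using C(1) continuous_src image_compactin by (auto simp: compact_open_bisection_def)
    show "openin (unit_top G) (src G ` C)"
      using C(1) openin_src_image by (auto simp: compact_open_bisection_def open_bisection_iff)
    show "x \<in> src G ` C" using C(2) src_unit[OF x] by force
    show "src G ` C \<subseteq> V" using C(3) by auto
  qed
qed

text \<open>A finite cover of \<open>K\<close> by compact open sources can be made disjoint by set
  differences that stay open. Since the section is a subset of \<open>A\<close>, it inherits
  injectivity and range conditions from \<open>A\<close>.\<close>

lemma ex_source_section:
  assumes A: "openin (gtop G) A" and K: "compactin (unit_top G) K" "openin (unit_top G) K" "K \<subseteq> src G ` A"
  obtains E where "openin (gtop G) E" "E \<subseteq> A" "inj_on (src G) E" "src G ` E = K"
proof -
  define \<C> where "\<C> = {C. compact_open_bisection G C \<and> C \<subseteq> A}"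
  have srcC: "openin (unit_top G) (src G ` C)" "compactin (unit_top G) (src G ` C)" if "C \<in> \<C>" for C
    using that openin_src_image continuous_src image_compactin
    by (auto simp: \<C>_def compact_open_bisection_def open_bisection_iff)
  have "K \<subseteq> (\<Union>C\<in>\<C>. src G ` C)"
  proof
    fix x assume "x \<in> K"
    then obtain \<gamma> where "\<gamma> \<in> A" "x = src G \<gamma>" using K by auto
    then show "x \<in> (\<Union>C\<in>\<C>. src G ` C)"
      using ex_compact_open_bisection[OF A \<open>\<gamma> \<in> A\<close>] by (metis (mono_tags, lifting) UN_I \<C>_def image_eqI mem_Collect_eq)
  qed
  then obtain \<F> where F: "finite \<F>" "\<F> \<subseteq> (`) (src G) ` \<C>" "K \<subseteq> \<Union>\<F>"
    using K(1) srcC(1) unfolding compactin_def by (metis (no_types, lifting) imageE)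
  \<comment> \<open>The section is built over the whole finite union, which may exceed
    \<open>K\<close>; openness of \<open>K\<close> allows the restriction at the end.\<close>
  have "\<exists>E. openin (gtop G) E \<and> E \<subseteq> A \<and> inj_on (src G) E \<and> src G ` E = \<Union>\<F>"
    using F(1,2)
  proof (induction \<F> rule: finite_induct)
    case empty
    then show ?case by (intro exI[of _ "{}"]) auto
  next
    case (insert F \<F>)
    then obtain E where E: "openin (gtop G) E" "E \<subseteq> A" "inj_on (src G) E" "src G ` E = \<Union>\<F>" by auto
    obtain C where C: "C \<in> \<C>" "F = src G ` C" using insert.prems by auto
    \<comment> \<open>\<open>F\<close> is clopen, so \<open>E\<close> can be kept off
      \<open>F\<close> as an open set while \<open>C\<close> takes over on \<open>F\<close>; no two
      arrows then share a source.\<close>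
    have "closedin (unit_top G) F"
      using srcC C Hausdorff_unit_top compactin_imp_closedin by blast
    then have "openin (unit_top G) (units G - F)"
      by (simp add: closedin_def topspace_unit_top)
    then have "openin (gtop G) {\<gamma> \<in> E. src G \<gamma> \<in> units G - F}"
      by (rule openin_restrict_src[OF E(1)])
    moreover have "openin (gtop G) C"
      using C(1) by (simp add: \<C>_def compact_open_bisection_def open_bisection_iff)
    ultimately have "openin (gtop G) (C \<union> {\<gamma> \<in> E. src G \<gamma> \<in> units G - F})"
      by (rule openin_Un[rotated])
    moreover have "inj_on (src G) (C \<union> {\<gamma> \<in> E. src G \<gamma> \<in> units G - F})"
      unfolding inj_on_Un
    proof (intro conjI)
      show "inj_on (src G) C"
        using C(1) by (simp add: \<C>_def compact_open_bisection_def open_bisection_iff)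
      show "inj_on (src G) {\<gamma> \<in> E. src G \<gamma> \<in> units G - F}"
        using E(3) by (rule inj_on_subset) simp
      have "src G ` C \<subseteq> F" "src G ` {\<gamma> \<in> E. src G \<gamma> \<in> units G - F} \<inter> F = {}"
        using C(2) by auto
      then show "src G ` (C - {\<gamma> \<in> E. src G \<gamma> \<in> units G - F}) \<inter>
          src G ` ({\<gamma> \<in> E. src G \<gamma> \<in> units G - F} - C) = {}"
        by blast
    qed
    moreover have "src G ` (C \<union> {\<gamma> \<in> E. src G \<gamma> \<in> units G - F}) = F \<union> \<Union>\<F>"
    proof -
      have "src G ` E \<subseteq> units G" using openin_subset[OF E(1)] src_in_units by blast
      then have "src G ` {\<gamma> \<in> E. src G \<gamma> \<in> units G - F} = \<Union>\<F> - F"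
        unfolding E(4)[symmetric] by auto
      then show ?thesis unfolding image_Un C(2)[symmetric] by blast
    qed
    ultimately show ?case
      using E(2) C(1) by (intro exI[of _ "C \<union> {\<gamma> \<in> E. src G \<gamma> \<in> units G - F}"]) (auto simp: \<C>_def)
  qed
  then obtain E where E: "openin (gtop G) E" "E \<subseteq> A" "inj_on (src G) E" "src G ` E = \<Union>\<F>" by auto
  show thesis
  proof
    show "openin (gtop G) {\<gamma> \<in> E. src G \<gamma> \<in> K}" using E(1) K openin_restrict_src by auto
    have "K \<subseteq> src G ` E" using E(4) F(3) by simp
    then show "src G ` {\<gamma> \<in> E. src G \<gamma> \<in> K} = K" by auto
  qed (use E in \<open>auto simp: inj_on_def\<close>)
qed

text \<open>Disjointness of the ranges makes \<open>rng G\<close> injective on the union of the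
  witnesses. Only the source map may fail to be injective there, and passing to a section repairs
  this.\<close>

lemma compact_subeq_bisectionE:
  assumes "compact_subeq G K V" "compactin (unit_top G) K" "openin (unit_top G) K"
  obtains E where "open_bisection G E" "src G ` E = K" "rng G ` E \<subseteq> V"
proof -
  obtain n A where A: "\<forall>i<(n::nat). open_bisection G (A i)" "K \<subseteq> (\<Union>i<n. src G ` A i)"
      "\<forall>i<n. rng G ` A i \<subseteq> V" "disjoint_family_on (\<lambda>i. rng G ` A i) {..<n}"
    using assms(1) unfolding compact_subeq_def by auto
  define B where "B = (\<Union>i<n. A i)"
  have "openin (gtop G) B" using A(1) by (auto simp: B_def open_bisection_iff)
  moreover have "K \<subseteq> src G ` B" using A(2) by (simp add: B_def image_UN)
  ultimately obtain E where E: "openin (gtop G) E" "E \<subseteq> B" "inj_on (src G) E" "src G ` E = K"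
    using assms ex_source_section by metis
  have "inj_on (rng G) B"
  proof (rule inj_onI)
    fix \<gamma> \<delta> assume h: "\<gamma> \<in> B" "\<delta> \<in> B" "rng G \<gamma> = rng G \<delta>"
    then obtain i j where ij: "i < n" "j < n" "\<gamma> \<in> A i" "\<delta> \<in> A j" by (auto simp: B_def)
    have "i = j"
    proof (rule ccontr)
      assume "i \<noteq> j"
      then have "rng G ` A i \<inter> rng G ` A j = {}"
        using A(4) ij by (auto simp: disjoint_family_on_def)
      then show False using ij h by (auto simp: disjoint_iff)
    qed
    then show "\<gamma> = \<delta>" using A(1) ij h by (auto simp: open_bisection_iff inj_on_def)
  qed
  then have "open_bisection G E" using E by (auto simp: open_bisection_iff intro: inj_on_subset)
  moreover have "rng G ` E \<subseteq> V" using E(2) A(3) by (force simp: B_def)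
  ultimately show thesis using that E(4) by blast
qed

lemma compact_subeq_mono_left: "compact_subeq G K V \<Longrightarrow> L \<subseteq> K \<Longrightarrow> compact_subeq G L V"
  unfolding compact_subeq_def by (meson subset_trans)

lemma compact_subeq_mono_right: "compact_subeq G K V \<Longrightarrow> V \<subseteq> W \<Longrightarrow> compact_subeq G K W"
  unfolding compact_subeq_def by (meson subset_trans)

section \<open>Minimality and the absence of isolated points\<close>

text \<open>The range map is open, so the complement of the saturation is closed. It is also
  invariant, hence trivial by minimality.\<close>

lemma saturation_eq_units:
  assumes V: "openin (unit_top G) V" "V \<noteq> {}"
  shows "rng G ` {\<gamma> \<in> arrows G. src G \<gamma> \<in> V} = units G"
proof -
  define S where "S = rng G ` {\<gamma> \<in> arrows G. src G \<gamma> \<in> V}"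
  define D where "D = units G - S"
  have Vu: "V \<subseteq> units G" using V openin_subset topspace_unit_top by blast
  have "openin (unit_top G) S"
    unfolding S_def using openin_rng_image openin_restrict_src[OF openin_topspace V(1)] by blast
  then have "closedin (unit_top G) D"
    unfolding D_def by (metis closedin_diff closedin_topspace topspace_unit_top)
  moreover have "invariant_set G D"
    unfolding invariant_set_def
  proof
    show Du: "D \<subseteq> units G" by (auto simp: D_def)
    have "rng G ` {\<gamma> \<in> arrows G. src G \<gamma> \<in> D} = D"
    proof (intro equalityI subsetI)
      fix x assume "x \<in> D"
      then show "x \<in> rng G ` {\<gamma> \<in> arrows G. src G \<gamma> \<in> D}"
        using Du units_subset_arrows rng_unit src_unit by (intro image_eqI[of _ _ x]) auto
    next
      fix x assume "x \<in> rng G ` {\<gamma> \<in> arrows G. src G \<gamma> \<in> D}"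
      then obtain \<gamma> where g: "\<gamma> \<in> arrows G" "src G \<gamma> \<in> D" "x = rng G \<gamma>" by auto
      \<comment> \<open>If the end of \<open>\<gamma>\<close> were reached from \<open>V\<close>,
        then going back along \<open>\<gamma>\<close> would show that its source is reached from
        \<open>V\<close> too.\<close>
      have "x \<notin> S"
      proof
        assume "x \<in> S"
        then obtain \<delta> where d: "\<delta> \<in> arrows G" "src G \<delta> \<in> V" "x = rng G \<delta>" by (auto simp: S_def)
        have c: "(ginv G \<gamma>, \<delta>) \<in> comps G"
          using g d by (subst comps_iff) (auto simp: inv_closed src_inv)
        have "src G \<gamma> \<in> S"
          unfolding S_def
          using c d g by (intro image_eqI[of _ _ "gmult G (ginv G \<gamma>) \<delta>"]) (auto simp: rng_mult src_mult rng_inv mult_closed)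
        then show False using g by (simp add: D_def)
      qed
      then show "x \<in> D" using g rng_in_units by (simp add: D_def)
    qed
    then show "rng G ` set_mult G (arrows G) D = D" using arrows_set_mult[OF Du] by simp
  qed
  ultimately have "D = {} \<or> D = units G"
    using minimal unfolding minimal_groupoid_def by blast
  \<comment> \<open>Units are arrows from themselves to themselves. As \<open>V\<close> is
    non-empty, this excludes the alternative \<open>D = units G\<close>.\<close>
  moreover have "V \<subseteq> S"
    using Vu units_subset_arrows rng_unit src_unit unfolding S_def by force
  moreover have "S \<subseteq> units G" by (auto simp: S_def rng_in_units)
  ultimately show ?thesis using V(2) Vu unfolding D_def S_def by blast
qed

lemma ex_arrow_into:
  assumes "openin (unit_top G) V" "V \<noteq> {}" "x \<in> units G"
  obtains \<gamma> where "\<gamma> \<in> arrows G" "src G \<gamma> = x" "rng G \<gamma> \<in> V"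
proof -
  obtain \<delta> where "\<delta> \<in> arrows G" "src G \<delta> \<in> V" "x = rng G \<delta>"
    using saturation_eq_units[OF assms(1,2)] assms(3) by blast
  then show thesis using that[of "ginv G \<delta>"] by (simp add: inv_closed src_inv rng_inv)
qed

text \<open>The local form of minimality: a basic bisection around an arrow from \<open>x\<close>
  into \<open>V\<close> is cut down to the arrows ending in \<open>V\<close>, which keeps the given
  arrow.\<close>

lemma ex_bisection_into:
  assumes "openin (unit_top G) V" "V \<noteq> {}" "x \<in> units G"
  obtains B where "open_bisection G B" "x \<in> src G ` B" "rng G ` B \<subseteq> V"
proof -
  obtain \<gamma> where g: "\<gamma> \<in> arrows G" "src G \<gamma> = x" "rng G \<gamma> \<in> V"
    using ex_arrow_into[OF assms] .
  obtain C where "compact_open_bisection G C" "\<gamma> \<in> C"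
    using ex_compact_open_bisection[OF openin_topspace g(1)] by metis
  then have "open_bisection G {\<delta> \<in> C. rng G \<delta> \<in> V}" "\<gamma> \<in> {\<delta> \<in> C. rng G \<delta> \<in> V}"
    using assms(1) g(3) open_bisection_restrict_rng by (auto simp: compact_open_bisection_def)
  then show thesis using that[of "{\<delta> \<in> C. rng G \<delta> \<in> V}"] g(2) by blast
qed

text \<open>An isolated point would, by minimality, be joined to every unit by a bisection and hence make
  the compact unit space discrete.\<close>

lemma not_open_singleton: "\<not> openin (unit_top G) {x}"
proof
  assume x: "openin (unit_top G) {x}"
  have "openin (unit_top G) {y}" if y: "y \<in> units G" for y
  proof -
    obtain B where B: "open_bisection G B" "y \<in> src G ` B" "rng G ` B \<subseteq> {x}"
      using ex_bisection_into[OF x insert_not_empty y] .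
    then obtain b where "b \<in> B" "y = src G b" by auto
    \<comment> \<open>On \<open>B\<close> the range map is injective and takes only the value
      \<open>x\<close>.\<close>
    then have "B = {b}" using B by (auto simp: open_bisection_iff inj_on_def image_subset_iff)
    then have "src G ` B = {y}" using \<open>y = src G b\<close> by simp
    then show ?thesis using B(1) openin_src_image by (metis open_bisection_iff)
  qed
  then have "unit_top G = discrete_topology (units G)"
    using topspace_unit_top discrete_topology_unique by metis
  then show False
    using compact infinite by (simp add: compact_space_discrete_topology)
qed

lemma ex_two_disjoint_open:
  assumes V: "openin (unit_top G) V" "V \<noteq> {}"
  obtains V1 V2 where "openin (unit_top G) V1" "openin (unit_top G) V2" "V1 \<noteq> {}" "V2 \<noteq> {}"
    "V1 \<subseteq> V" "V2 \<subseteq> V" "V1 \<inter> V2 = {}"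
proof -
  obtain x where x: "x \<in> V" using V by auto
  then have "V \<noteq> {x}" using V not_open_singleton by auto
  then obtain y where y: "y \<in> V" "y \<noteq> x" using x by auto
  have "x \<in> topspace (unit_top G)" "y \<in> topspace (unit_top G)" using x y V openin_subset by blast+
  then obtain S T where "openin (unit_top G) S" "openin (unit_top G) T" "x \<in> S" "y \<in> T" "disjnt S T"
    using y(2) Hausdorff_unit_top unfolding Hausdorff_space_def by metis
  then show thesis using that[of "S \<inter> V" "T \<inter> V"] x y V by (auto simp: disjnt_def)
qed

text \<open>One half of a splitting is kept and the other is split again, so the induction has to
  let \<open>V\<close> vary.\<close>

lemma ex_disjoint_family_open:
  assumes "openin (unit_top G) V" "V \<noteq> {}"
  shows "\<exists>W. (\<forall>i<n. openin (unit_top G) (W i) \<and> W i \<noteq> {} \<and> W i \<subseteq> V) \<and> disjoint_family_on W {..<n::nat}"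
  using assms
proof (induction n arbitrary: V)
  case 0
  then show ?case by (auto simp: disjoint_family_on_def)
next
  case (Suc n)
  obtain V1 V2 where V12: "openin (unit_top G) V1" "openin (unit_top G) V2" "V1 \<noteq> {}" "V2 \<noteq> {}"
    "V1 \<subseteq> V" "V2 \<subseteq> V" "V1 \<inter> V2 = {}"
    using ex_two_disjoint_open[OF Suc.prems] .
  obtain W where W: "\<forall>i<n. openin (unit_top G) (W i) \<and> W i \<noteq> {} \<and> W i \<subseteq> V2" "disjoint_family_on W {..<n}"
    using Suc.IH[OF V12(2,4)] by auto
  have "disjoint_family_on (W(n := V1)) {..<Suc n}"
    using W V12(7) by (fastforce simp: disjoint_family_on_def less_Suc_eq)
  moreover have "\<forall>i<Suc n. openin (unit_top G) ((W(n := V1)) i) \<and> (W(n := V1)) i \<noteq> {} \<and> (W(n := V1)) i \<subseteq> V"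
    using W(1) V12(1,3,5,6) by (auto simp: less_Suc_eq)
  ultimately show ?case by blast
qed

section \<open>The pivotal condition, pure infiniteness and comparison\<close>

text \<open>The compact unit space is its own largest compact subset, so
  \<open>compact_subeq\<close> for it alone covers every smaller compact set by
  monotonicity.\<close>

definition units_subeq_all :: bool where
  "units_subeq_all \<longleftrightarrow> (\<forall>V. openin (unit_top G) V \<and> V \<noteq> {} \<longrightarrow> compact_subeq G (units G) V)"

lemma units_subeq_all_imp_open_subeq:
  assumes units_subeq_all "openin (unit_top G) U" "openin (unit_top G) V" "V \<noteq> {}"
  shows "open_subeq G U V"
proof -
  have "compact_subeq G (units G) V" using assms by (auto simp: units_subeq_all_def)
  then show ?thesis
    unfolding open_subeq_def
    using compact_subeq_mono_left compactin_subset_topspace topspace_unit_top by metis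
qed

lemma units_subeq_all_imp_purely_infinite:
  assumes units_subeq_all
  shows "purely_infinite G"
  unfolding purely_infinite_def open_subeq2_def
proof (intro allI impI, elim conjE)
  fix O1 V F assume V: "openin (unit_top G) V" "V \<noteq> {}" and F: "compactin (unit_top G) F"
  obtain V1 V2 where V12: "openin (unit_top G) V1" "openin (unit_top G) V2" "V1 \<noteq> {}" "V2 \<noteq> {}"
    "V1 \<subseteq> V" "V2 \<subseteq> V" "V1 \<inter> V2 = {}"
    using ex_two_disjoint_open[OF V] .
  have "F \<subseteq> units G" using F compactin_subset_topspace topspace_unit_top by metis
  then have "compact_subeq G F V1" "compact_subeq G F V2"
    using assms V12 compact_subeq_mono_left by (auto simp: units_subeq_all_def)
  then show "\<exists>O1 O2. openin (unit_top G) O1 \<and> openin (unit_top G) O2 \<and> O1 \<noteq> {} \<and> O2 \<noteq> {} \<and>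
      O1 \<inter> O2 = {} \<and> O1 \<subseteq> V \<and> O2 \<subseteq> V \<and> compact_subeq G F O1 \<and> compact_subeq G F O2"
    using V12 by blast
qed

text \<open>Minimality makes the saturation of \<open>V\<close> everything, so the whole unit space
  is admissible as the first set.\<close>

lemma purely_infinite_units:
  assumes "purely_infinite G" "openin (unit_top G) V" "V \<noteq> {}"
  shows "open_subeq2 G (units G) V"
proof -
  have "V \<subseteq> units G" using assms openin_subset topspace_unit_top by blast
  then have "units G \<subseteq> rng G ` set_mult G (arrows G) V"
    using saturation_eq_units[OF assms(2,3)] arrows_set_mult by simp
  then show ?thesis
    using assms openin_units units_nonempty unfolding purely_infinite_def by blast
qed

lemma purely_infinite_imp_units_subeq_all:
  assumes "purely_infinite G"
  shows units_subeq_all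
  unfolding units_subeq_all_def
proof (intro allI impI, elim conjE)
  fix V assume "openin (unit_top G) V" "V \<noteq> {}"
  then have "open_subeq2 G (units G) V" using purely_infinite_units[OF assms] by blast
  then show "compact_subeq G (units G) V"
    using compactin_units compact_subeq_mono_right unfolding open_subeq2_def by (meson subset_refl)
qed

text \<open>One bisection carries the whole unit space into \<open>V\<close>, and invariance says
  that it preserves the total mass.\<close>

lemma invariant_measure_compact_subeq:
  assumes \<mu>: "\<mu> \<in> invariant_prob_measures G"
    and V: "openin (unit_top G) V" "compact_subeq G (units G) V"
  shows "measure \<mu> V = 1"
proof -
  interpret prob_space \<mu> using \<mu> by (simp add: invariant_prob_measures_def)
  have sets: "sets \<mu> = sets (borel_on (unit_top G))"
    using \<mu> by (simp add: invariant_prob_measures_def)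
  have Pow: "{U. openin (unit_top G) U} \<subseteq> Pow (topspace (unit_top G))"
    using openin_subset by blast
  have "space \<mu> = units G"
    using sets_eq_imp_space_eq[OF sets] space_measure_of[OF Pow]
    by (simp add: borel_on_def topspace_unit_top)
  have "V \<in> sets \<mu>"
    unfolding sets borel_on_def using V(1) by (simp add: sets_measure_of[OF Pow] sigma_sets.Basic)
  obtain E where E: "open_bisection G E" "src G ` E = units G" "rng G ` E \<subseteq> V"
    using compact_subeq_bisectionE[OF V(2) compactin_units openin_units] .
  have "measure \<mu> (rng G ` E) = measure \<mu> (src G ` E)"
    using \<mu> E(1) by (simp add: invariant_prob_measures_def)
  then have "measure \<mu> (rng G ` E) = 1"
    using E(2) prob_space \<open>space \<mu> = units G\<close> by simp
  moreover have "measure \<mu> (rng G ` E) \<le> measure \<mu> V"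
    using finite_measure_mono[OF E(3) \<open>V \<in> sets \<mu>\<close>] .
  ultimately show ?thesis using prob_le_1[of V] by simp
qed

lemma purely_infinite_imp_no_invariant_measure:
  assumes "purely_infinite G"
  shows "invariant_prob_measures G = {}"
proof (rule ccontr)
  assume "invariant_prob_measures G \<noteq> {}"
  then obtain \<mu> where \<mu>: "\<mu> \<in> invariant_prob_measures G" by auto
  interpret prob_space \<mu> using \<mu> by (simp add: invariant_prob_measures_def)
  have "units_subeq_all" using purely_infinite_imp_units_subeq_all[OF assms] .
  moreover obtain V1 V2 where V12: "openin (unit_top G) V1" "openin (unit_top G) V2" "V1 \<noteq> {}" "V2 \<noteq> {}"
    "V1 \<inter> V2 = {}"
    using ex_two_disjoint_open[OF openin_units units_nonempty] by metis
  ultimately have m: "measure \<mu> V1 = 1" "measure \<mu> V2 = 1"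
    using invariant_measure_compact_subeq[OF \<mu>] by (auto simp: units_subeq_all_def)
  \<comment> \<open>\<open>measure\<close> is 0 by default on non-measurable sets, so a set of mass
    1 must be measurable.\<close>
  have "V1 \<in> sets \<mu>" "V2 \<in> sets \<mu>"
    using m by (metis measure_notin_sets zero_neq_one)+
  then have "measure \<mu> (V1 \<union> V2) = 2"
    using finite_measure_Union V12(5) m by auto
  then show False using prob_le_1[of "V1 \<union> V2"] by simp
qed

text \<open>Without invariant measures the inequality required by comparison holds vacuously, so
  comparison relates all open sets to all non-empty ones.\<close>

lemma purely_infinite_iff_comparison:
  "groupoid_comparison G \<and> invariant_prob_measures G = {} \<longleftrightarrow> purely_infinite G"
proof
  assume "groupoid_comparison G \<and> invariant_prob_measures G = {}"
  then have units_subeq_all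
    using openin_units compactin_units
    unfolding units_subeq_all_def groupoid_comparison_def open_subeq_def by blast
  then show "purely_infinite G" by (rule units_subeq_all_imp_purely_infinite)
next
  assume "purely_infinite G"
  then show "groupoid_comparison G \<and> invariant_prob_measures G = {}"
    using purely_infinite_imp_units_subeq_all units_subeq_all_imp_open_subeq
      purely_infinite_imp_no_invariant_measure
    unfolding groupoid_comparison_def by blast
qed

section \<open>Pure infiniteness in the sense of Matui\<close>

lemma units_subeq_all_imp_Matui:
  assumes units_subeq_all
  shows "purely_infinite_Matui G"
  unfolding purely_infinite_Matui_def
proof (intro allI impI, elim conjE)
  fix S assume S: "compactin (unit_top G) S" "openin (unit_top G) S"
  show "\<exists>U V. compact_open_bisection G U \<and> compact_open_bisection G V \<and>
        src G ` U = S \<and> src G ` V = S \<and> rng G ` U \<inter> rng G ` V = {} \<and> rng G ` U \<union> rng G ` V \<subseteq> S"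
  proof (cases "S = {}")
    case True
    then show ?thesis
      by (intro exI[of _ "{}"]) (simp add: compact_open_bisection_def open_bisection_iff)
  next
    case False
    obtain V1 V2 where V12: "openin (unit_top G) V1" "openin (unit_top G) V2" "V1 \<noteq> {}" "V2 \<noteq> {}"
      "V1 \<subseteq> S" "V2 \<subseteq> S" "V1 \<inter> V2 = {}"
      using ex_two_disjoint_open[OF S(2) False] .
    have "S \<subseteq> units G" using S compactin_subset_topspace topspace_unit_top by metis
    then have "compact_subeq G S V1" "compact_subeq G S V2"
      using assms V12 compact_subeq_mono_left by (auto simp: units_subeq_all_def)
    then obtain U V where UV: "open_bisection G U" "src G ` U = S" "rng G ` U \<subseteq> V1"
      "open_bisection G V" "src G ` V = S" "rng G ` V \<subseteq> V2"
      using compact_subeq_bisectionE S by metis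
    then have "compact_open_bisection G U" "compact_open_bisection G V"
      using S(1) compactin_open_bisection by (auto simp: compact_open_bisection_def)
    moreover have "rng G ` U \<inter> rng G ` V = {}" "rng G ` U \<union> rng G ` V \<subseteq> S"
      using Int_mono[OF UV(3,6)] UV(3,6) V12(5-7) by auto
    ultimately show ?thesis using UV(2,5) by (intro exI[of _ U] exI[of _ V]) simp
  qed
qed

text \<open>Matui's condition provides two copies of \<open>S\<close> in \<open>S\<close>. One is
  kept, and the copies found so far are pushed through the other, so their number grows by one at
  each step.\<close>

lemma Matui_disjoint_copies:
  assumes M: "purely_infinite_Matui G" and S: "compactin (unit_top G) S" "openin (unit_top G) S"
  shows "\<exists>U. (\<forall>i<n. open_bisection G (U i) \<and> src G ` U i = S \<and> rng G ` U i \<subseteq> S) \<and>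
    disjoint_family_on (\<lambda>i. rng G ` U i) {..<n::nat}"
proof (induction n)
  case 0
  then show ?case by (auto simp: disjoint_family_on_def)
next
  case (Suc n)
  then obtain U where "\<forall>i<n. open_bisection G (U i) \<and> src G ` U i = S \<and> rng G ` U i \<subseteq> S"
    "disjoint_family_on (\<lambda>i. rng G ` U i) {..<n}" by blast
  then have U: "\<And>i. i < n \<Longrightarrow> open_bisection G (U i)" "\<And>i. i < n \<Longrightarrow> src G ` U i = S"
    "\<And>i. i < n \<Longrightarrow> rng G ` U i \<subseteq> S" "disjoint_family_on (\<lambda>i. rng G ` U i) {..<n}" by auto
  obtain P Q where PQ: "open_bisection G P" "open_bisection G Q" "src G ` P = S" "src G ` Q = S"
      "rng G ` P \<inter> rng G ` Q = {}" "rng G ` P \<subseteq> S" "rng G ` Q \<subseteq> S"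
    using M S unfolding purely_infinite_Matui_def compact_open_bisection_def by (metis le_sup_iff)
  define W where "W = (\<lambda>i. if i < n then set_mult G Q (U i) else P)"
  have WU: "open_bisection G (W i)" "src G ` W i = S" "rng G ` W i \<subseteq> rng G ` Q" if "i < n" for i
    using that set_mult_src_rng[of Q "U i"] PQ U open_bisection_mult open_bisection_subset
    by (simp_all add: W_def)
  \<comment> \<open>Products with equal range share their factor in \<open>Q\<close>, because
    \<open>rng G\<close> is injective there; their right factors then have equal range, against the
    disjointness of the \<open>U i\<close>.\<close>
  have disj: "rng G ` W i \<inter> rng G ` W j = {}" if "i < n" "j < n" "i \<noteq> j" for i j
  proof (rule ccontr)
    assume "rng G ` W i \<inter> rng G ` W j \<noteq> {}"
    then have "rng G ` set_mult G Q (U i) \<inter> rng G ` set_mult G Q (U j) \<noteq> {}"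
      using that by (simp add: W_def)
    then obtain q q' u u' where h: "rng G (gmult G q u) = rng G (gmult G q' u')" "q \<in> Q" "q' \<in> Q"
      "u \<in> U i" "u' \<in> U j" "(q, u) \<in> comps G" "(q', u') \<in> comps G"
      by (auto simp: set_mult_def)
    then have "q = q'" using PQ(2) by (simp add: rng_mult open_bisection_iff inj_on_def)
    then have "rng G u = rng G u'"
      using h comps_iff comps_subset by (metis (no_types, lifting) SigmaE2 subsetD)
    moreover have "rng G ` U i \<inter> rng G ` U j = {}"
      using U(4) that by (auto simp: disjoint_family_on_def)
    ultimately show False using h by (auto simp: disjoint_iff)
  qed
  have "disjoint_family_on (\<lambda>i. rng G ` W i) {..<Suc n}"
    unfolding disjoint_family_on_def
  proof (intro ballI impI)
    fix i j assume ij: "i \<in> {..<Suc n}" "j \<in> {..<Suc n}" "i \<noteq> j"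
    have "W n = P" by (simp add: W_def)
    then show "rng G ` W i \<inter> rng G ` W j = {}"
      using ij disj[of i j] WU(3)[of i] WU(3)[of j] PQ(5) by (cases "i = n"; cases "j = n") auto
  qed
  moreover have "open_bisection G (W i) \<and> src G ` W i = S \<and> rng G ` W i \<subseteq> S" if "i < Suc n" for i
    using that WU[of i] PQ by (cases "i = n") (auto simp: W_def)
  ultimately show ?case by blast
qed

text \<open>Matui's condition speaks of compact open sets, hence the passage from \<open>V\<close>
  to \<open>S\<close>. Each copy has all of \<open>S\<close> as its source, so composing with it is
  possible along the whole range of \<open>B i\<close> and the sources still cover the unit
  space.\<close>

lemma Matui_imp_units_subeq_all:
  assumes M: "purely_infinite_Matui G"
  shows units_subeq_all
  unfolding units_subeq_all_def
proof (intro allI impI, elim conjE)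
  fix V assume V: "openin (unit_top G) V" "V \<noteq> {}"
  then obtain S where S: "compactin (unit_top G) S" "openin (unit_top G) S" "S \<noteq> {}" "S \<subseteq> V"
    using ex_compact_open by (metis empty_iff ex_in_conv)
  define \<B> where "\<B> = {B. open_bisection G B \<and> rng G ` B \<subseteq> S}"
  have "units G \<subseteq> (\<Union>B\<in>\<B>. src G ` B)"
  proof
    fix x assume "x \<in> units G"
    then obtain B where "open_bisection G B" "x \<in> src G ` B" "rng G ` B \<subseteq> S"
      using ex_bisection_into[OF S(2,3)] by metis
    then show "x \<in> (\<Union>B\<in>\<B>. src G ` B)" by (auto simp: \<B>_def)
  qed
  moreover have "\<forall>U\<in>(`) (src G) ` \<B>. openin (unit_top G) U"
    using openin_src_image by (auto simp: \<B>_def open_bisection_iff)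
  ultimately obtain \<F> where F: "finite \<F>" "\<F> \<subseteq> (`) (src G) ` \<B>" "units G \<subseteq> \<Union>\<F>"
    using compactin_units unfolding compactin_def by metis
  obtain \<F>' where F': "\<F>' \<subseteq> \<B>" "finite \<F>'" "\<F> = (`) (src G) ` \<F>'"
    using finite_subset_image[OF F(1,2)] by auto
  \<comment> \<open>The finite set of bisections is enumerated so that the \<open>i\<close>-th one
    can be paired with the \<open>i\<close>-th copy of \<open>S\<close>.\<close>
  obtain n and B :: "nat \<Rightarrow> 'a set" where B: "\<F>' = B ` {..<n}"
    using finite_imp_nat_seg_image_inj_on[OF F'(2)] by (auto simp: lessThan_def)
  have Bi: "open_bisection G (B i)" "rng G ` B i \<subseteq> S" if "i < n" for i
    using that F'(1) B by (auto simp: \<B>_def)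
  obtain U where U: "\<And>i. i < n \<Longrightarrow> open_bisection G (U i)" "\<And>i. i < n \<Longrightarrow> src G ` U i = S"
    "\<And>i. i < n \<Longrightarrow> rng G ` U i \<subseteq> S" "disjoint_family_on (\<lambda>i. rng G ` U i) {..<n}"
    using Matui_disjoint_copies[OF M S(1,2)] by metis
  define A where "A = (\<lambda>i. set_mult G (U i) (B i))"
  have A: "open_bisection G (A i)" "src G ` A i = src G ` B i" "rng G ` A i \<subseteq> rng G ` U i" if "i < n" for i
    using that set_mult_src_rng[of "U i" "B i"] Bi U open_bisection_mult open_bisection_subset
    by (simp_all add: A_def)
  have "units G \<subseteq> (\<Union>i<n. src G ` A i)" using F(3) F'(3) B A(2) by auto
  moreover have "disjoint_family_on (\<lambda>i. rng G ` A i) {..<n}"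
    unfolding disjoint_family_on_def
  proof (intro ballI impI)
    fix i j assume ij: "i \<in> {..<n}" "j \<in> {..<n}" "i \<noteq> j"
    then have "rng G ` U i \<inter> rng G ` U j = {}" using U(4) by (simp add: disjoint_family_on_def)
    then show "rng G ` A i \<inter> rng G ` A j = {}" using ij Int_mono[OF A(3)[of i] A(3)[of j]] by simp
  qed
  moreover have "\<forall>i<n. rng G ` A i \<subseteq> V" using A(3) U(3) S(4) by blast
  ultimately show "compact_subeq G (units G) V"
    unfolding compact_subeq_def using A(1) by (intro exI[of _ n] exI[of _ A]) simp
qed

section \<open>Filling and local contraction\<close>

lemma units_subeq_all_imp_1_filling:
  assumes units_subeq_all
  shows "n_filling 1 G"
  unfolding n_filling_def
proof (intro allI impI, elim conjE)
  fix W assume W: "openin (unit_top G) W" "W \<noteq> {}"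
  then have "compact_subeq G (units G) W" using assms by (simp add: units_subeq_all_def)
  then obtain E where E: "open_bisection G E" "src G ` E = units G" "rng G ` E \<subseteq> W"
    using compact_subeq_bisectionE[OF _ compactin_units openin_units] by blast
  have a: "E \<subseteq> arrows G" "ginv G ` E \<subseteq> arrows G"
    using open_bisection_subset open_bisection_inv E(1) by auto
  have "W \<subseteq> units G" using W openin_subset topspace_unit_top by blast
  then have "set_mult G (ginv G ` E) W = {\<gamma> \<in> ginv G ` E. src G \<gamma> \<in> W}"
    by (rule set_mult_units[OF a(2)])
  \<comment> \<open>Sources of the inverse bisection are ranges of \<open>E\<close>, which lie in
    \<open>W\<close>, so the restriction removes nothing.\<close>
  also have "\<dots> = ginv G ` E"
    using E(3) a(1) src_inv by (auto simp: image_subset_iff subset_iff)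
  finally have "set_mult G (ginv G ` E) W = ginv G ` E" .
  then have "rng G ` set_mult G (ginv G ` E) W = units G"
    using rng_inv_image[OF a(1)] E(2) by simp
  then show "\<exists>E. (\<forall>i<1::nat. open_bisection G (E i)) \<and> (\<Union>i<1::nat. rng G ` set_mult G (E i) W) = units G"
    using open_bisection_inv[OF E(1)] by (intro exI[of _ "\<lambda>_. ginv G ` E"]) auto
qed

text \<open>By minimality a small neighbourhood of a point is moved by bisections into \<open>n\<close> disjoint
  subsets of \<open>V\<close>; filling with this neighbourhood then yields \<open>n\<close> bisections with disjoint ranges
  in \<open>V\<close>.\<close>

lemma n_filling_imp_units_subeq_all:
  assumes "n_filling n G"
  shows units_subeq_all
  unfolding units_subeq_all_def
proof (intro allI impI, elim conjE)
  fix V assume V: "openin (unit_top G) V" "V \<noteq> {}"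
  obtain W where W: "\<And>i. i < n \<Longrightarrow> openin (unit_top G) (W i)" "\<And>i. i < n \<Longrightarrow> W i \<noteq> {}"
      "\<And>i. i < n \<Longrightarrow> W i \<subseteq> V" "disjoint_family_on W {..<n}"
    using ex_disjoint_family_open[OF V] by metis
  obtain x where x: "x \<in> units G" using units_nonempty by auto
  have "\<exists>B. open_bisection G B \<and> x \<in> src G ` B \<and> rng G ` B \<subseteq> W i" if "i < n" for i
    using ex_bisection_into[OF W(1,2)[OF that] x] by metis
  then obtain B where B: "\<And>i. i < n \<Longrightarrow> open_bisection G (B i)" "\<And>i. i < n \<Longrightarrow> x \<in> src G ` B i"
      "\<And>i. i < n \<Longrightarrow> rng G ` B i \<subseteq> W i" by metis
  \<comment> \<open>The factor \<open>units G\<close> keeps \<open>N\<close> inside the unit space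
    also for \<open>n = 0\<close>, where the indexed intersection is the whole type.\<close>
  define N where "N = units G \<inter> (\<Inter>i<n. src G ` B i)"
  have N: "openin (unit_top G) N"
    using openin_Int_Inter[of "(\<lambda>i. src G ` B i) ` {..<n}" "unit_top G" "units G"] openin_units
      B(1) openin_src_image by (auto simp: N_def open_bisection_iff)
  have "x \<in> N" using x B(2) by (simp add: N_def)
  then obtain E where E: "\<And>i. i < n \<Longrightarrow> open_bisection G (E i)"
      "(\<Union>i<n. rng G ` set_mult G (E i) N) = units G"
    using assms N unfolding n_filling_def by (metis empty_iff)
  define F where "F = (\<lambda>i. {\<gamma> \<in> E i. src G \<gamma> \<in> N})"
  have F: "open_bisection G (F i)" "F i \<subseteq> arrows G" "set_mult G (E i) N = F i" if "i < n" for i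
  proof -
    show F: "open_bisection G (F i)"
      unfolding F_def using open_bisection_restrict_src[OF E(1)[OF that] N] .
    show "F i \<subseteq> arrows G" using open_bisection_subset[OF F] .
    show "set_mult G (E i) N = F i"
      unfolding F_def using open_bisection_subset[OF E(1)[OF that]] by (rule set_mult_units) (simp add: N_def)
  qed
  \<comment> \<open>Arrows of \<open>F i\<close> start in \<open>N\<close>. Their inverses end
    there, within the source of \<open>B i\<close>, which carries them on into
    \<open>W i\<close>.\<close>
  define A where "A = (\<lambda>i. set_mult G (B i) (ginv G ` F i))"
  have A: "open_bisection G (A i) \<and> src G ` A i = rng G ` F i \<and> rng G ` A i \<subseteq> W i" if "i < n" for i
  proof -
    have Fi: "open_bisection G (ginv G ` F i)" using F(1) that open_bisection_inv by blast
    have "rng G ` ginv G ` F i \<subseteq> src G ` B i"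
      unfolding rng_inv_image[OF F(2)[OF that]] using that by (auto simp: F_def N_def)
    then show ?thesis
      unfolding A_def
      using set_mult_src_rng[of "B i" "ginv G ` F i"] open_bisection_mult[OF B(1)[OF that] Fi]
        open_bisection_subset[OF Fi] open_bisection_subset[OF B(1)[OF that]]
        src_inv_image[OF F(2)[OF that]] B(3)[OF that] by auto
  qed
  have "units G \<subseteq> (\<Union>i<n. src G ` A i)" using E(2) A F(3) by auto
  moreover have "disjoint_family_on (\<lambda>i. rng G ` A i) {..<n}"
    using W(4) A unfolding disjoint_family_on_def by (metis (no_types, lifting) Int_mono lessThan_iff subset_empty)
  moreover have "\<forall>i<n. rng G ` A i \<subseteq> V" using A W(3) by blast
  ultimately show "compact_subeq G (units G) V"
    unfolding compact_subeq_def using A by (intro exI[of _ n] exI[of _ A]) simp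
qed

text \<open>A compact open set is its own closure, so \<open>S\<close> itself can serve as the
  contracted set, with one of Matui's two bisections as the contraction.\<close>

lemma Matui_imp_locally_contracting:
  assumes "purely_infinite_Matui G"
  shows "locally_contracting G"
  unfolding locally_contracting_def
proof (intro allI impI, elim conjE)
  fix U assume U: "openin (unit_top G) U" "U \<noteq> {}"
  then obtain S where S: "compactin (unit_top G) S" "openin (unit_top G) S" "S \<noteq> {}" "S \<subseteq> U"
    using ex_compact_open by (metis empty_iff ex_in_conv)
  obtain P Q where PQ: "open_bisection G P" "open_bisection G Q" "src G ` P = S" "src G ` Q = S"
      "rng G ` P \<inter> rng G ` Q = {}" "rng G ` P \<subseteq> S" "rng G ` Q \<subseteq> S"
    using assms S unfolding purely_infinite_Matui_def compact_open_bisection_def by (metis le_sup_iff)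
  have "Q \<noteq> {}" using PQ(4) S(3) by auto
  \<comment> \<open>The inclusion is proper because the non-empty range of \<open>Q\<close> lies in
    \<open>S\<close> and misses the range of \<open>P\<close>.\<close>
  then have "rng G ` P \<subset> S" using PQ(5-7) by blast
  moreover have "unit_top G closure_of S = S"
    using S(1) Hausdorff_unit_top compactin_imp_closedin closure_of_closedin by blast
  moreover have "set_mult G P S = P"
    using set_mult_units[OF open_bisection_subset[OF PQ(1)], of S] PQ(3) S(1)
      compactin_subset_topspace[OF S(1)] topspace_unit_top by auto
  ultimately show "\<exists>V B. openin (unit_top G) V \<and> V \<subseteq> U \<and> open_bisection G B \<and>
        unit_top G closure_of V \<subseteq> src G ` B \<and> rng G ` set_mult G B (unit_top G closure_of V) \<subset> V"
    using S PQ(1,3) by (intro exI[of _ S] exI[of _ P]) auto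
qed

end

theorem theorem5p8:
  fixes G :: "('a, 'm) top_groupoid_scheme"
  assumes "etale_groupoid G"
    and "locally_compact_space (gtop G)"
    and "Hausdorff_space (gtop G)"
    and "ample G"
    and "minimal_groupoid G"
    and "compact_space (unit_top G)"
    and "infinite (units G)"
  shows "((groupoid_comparison G \<and> invariant_prob_measures G = {}) \<longleftrightarrow> purely_infinite G) \<and>
    (purely_infinite G \<longleftrightarrow> purely_infinite_Matui G) \<and>
    (purely_infinite_Matui G \<longleftrightarrow> (\<exists>n\<ge>1. n_filling n G)) \<and>
    ((\<exists>n\<ge>1. n_filling n G) \<longleftrightarrow> n_filling 1 G) \<and>
    (n_filling 1 G \<longrightarrow> locally_contracting G)"
proof -
  interpret minimal_ample_groupoid G
    using assms by (simp add: minimal_ample_groupoid_def minimal_ample_groupoid_axioms_def)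
  have "purely_infinite G \<longleftrightarrow> units_subeq_all"
    using units_subeq_all_imp_purely_infinite purely_infinite_imp_units_subeq_all by blast
  moreover have "purely_infinite_Matui G \<longleftrightarrow> units_subeq_all"
    using units_subeq_all_imp_Matui Matui_imp_units_subeq_all by blast
  moreover have "n_filling 1 G \<longleftrightarrow> units_subeq_all"
    using units_subeq_all_imp_1_filling n_filling_imp_units_subeq_all by blast
  moreover have "(\<exists>n\<ge>1. n_filling n G) \<longleftrightarrow> units_subeq_all"
    using units_subeq_all_imp_1_filling n_filling_imp_units_subeq_all by blast
  ultimately show ?thesis
    using purely_infinite_iff_comparison Matui_imp_locally_contracting by simp
qed

end
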